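(* Let $\mathcal{K}\in L(V,U)$, let $u_{f_0}=\mathcal{K}v_{f_0}$ with $v_{f_0}\in V$, let $h\in V$, and let $B_s(f_0)\subset\mathcal{F}$ and $B_r(u_{f_0})\subset U$ be open balls around $f_0\in\mathcal{F}$ and $u_{f_0}$. Let $C:B_r(u_{f_0})\times B_s(f_0)\to V$, $(u,f)\mapsto C(u;f)$, be such that $C(\cdot;f):B_r(u_{f_0})\to V$ satisfies a modulus of continuity $\omega_C$ uniformly for every $f\in B_s(f_0)$, i.e. $\|C(u_1;f)-C(u_2;f)\|_V\le\omega_C(\|u_1-u_2\|_U)$, and assume $C(\mathcal{K}v_{f_0};f_0)=v_{f_0}-h$. Assume that there exists an operator $A\in L(\mathcal{F},V)$ that is invertible with bounded inverse and satisfies $$\|C(u;f_1)-C(u;f_2)-A(f_1-f_2)\|_V\le\frac{\theta}{\|A^{-1}\|}\|f_1-f_2\|_{\mathcal{F}}$$ for every $u\in B_r(u_{f_0})$, $f_1,f_2\in B_s(f_0)$ and a fixed constant $\theta\in(0,1)$. Then there exist $\tilde r>0$ and a map $e:B_{\tilde r}(v_{f_0})\to B_s(f_0)$ with $e(v_{f_0})=f_0$ satisfying, for every $v,v_1,v_2\in B_{\tilde r}(v_{f_0})$, $$C(\mathcal{K}v;e(v))=v-h,\qquad\|e(v_1)-e(v_2)\|_{\mathcal{F}}\le\tilde\omega(\|v_1-v_2\|_V),$$ where $$\tilde\omega(t):=\frac{\|A^{-1}\|}{1-\theta}\bigl(t+\omega_C(\|\mathcal{K}\|t)\bigr).$$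
   Context: $U$, $V$, $\mathcal{F}$ are Banach spaces (in the paper: $U$ a closed subspace of $H^{2m}(\mathcal{O})$, $V=L^2(\mathcal{O})$, $\mathcal{F}$ a closed subspace of $H^l(\mathcal{O})$, with the paper stressing that the lemma is formulated in abstract Banach spaces). $L(X,Y)$ denotes bounded linear operators. A modulus of continuity is a non-decreasing function $\omega:[0,\infty)\to[0,\infty)$ with $\omega(0)=0$ and $\lim_{t\downarrow0}\omega(t)=0$. *)

theory Defs
  imports "HOL-Analysis.Analysis"
begin

text \<open>A function from the non-negative reals to themselves is represented by a total function on
  the reals, of which only the values on \<open>{0..}\<close> are constrained.\<close>

definition modulus_of_continuity :: "(real \<Rightarrow> real) \<Rightarrow> bool" where
  "modulus_of_continuity \<omega> \<longleftrightarrow>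
     (\<forall>t\<ge>0. 0 \<le> \<omega> t) \<and> mono_on {0..} \<omega> \<and> \<omega> 0 = 0 \<and> (\<omega> \<longlongrightarrow> 0) (at_right 0)"

definition inverse_blinfun ::
    "('a::real_normed_vector \<Rightarrow>\<^sub>L 'b::real_normed_vector) \<Rightarrow> ('b \<Rightarrow>\<^sub>L 'a) \<Rightarrow> bool" where
  "inverse_blinfun A B \<longleftrightarrow> A o\<^sub>L B = id_blinfun \<and> B o\<^sub>L A = id_blinfun"

end

theory Submission
  imports Defs
begin

text \<open>
  For fixed \<open>v\<close> near \<open>v\<^sub>0\<close>, the equation \<open>C (K v) f = v - h\<close> in the unknown \<open>f\<close> has a left-hand side
  that differs from the invertible linear map \<open>A\<close> by a map of Lipschitz constant
  \<open>\<theta> / norm Ainv\<close>, which is too small to destroy invertibility. Two facts about such near-linear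
  maps give the theorem. They are bounded below (\<open>near_linear_lower_bound\<close>), and they attain every
  value close enough to the value at the centre of a ball (\<open>near_linear_solvable\<close>, a contraction
  argument).

  At \<open>f\<^sub>0\<close> the equation for \<open>v\<close> has the defect \<open>(v - v\<^sub>0) + (C (K v\<^sub>0) f\<^sub>0 - C (K v) f\<^sub>0)\<close>, whose
  norm is at most \<open>norm (v - v\<^sub>0) + \<omega>\<^sub>C (norm K * norm (v - v\<^sub>0))\<close>. Since \<open>\<omega>\<^sub>C\<close> tends to zero at
  zero, the defect is small on a small ball, and a solution exists there.
  The lower bound, applied to solutions belonging to two points \<open>v\<^sub>1\<close> and \<open>v\<^sub>2\<close>, gives the
  estimate with \<open>\<omega>'\<close>. Any choice of solutions thus defines a suitable \<open>e\<close>, and the case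
  \<open>v\<^sub>1 = v\<^sub>2 = v\<^sub>0\<close> of the same estimate forces \<open>e v\<^sub>0 = f\<^sub>0\<close>, because \<open>\<omega>\<^sub>C 0 = 0\<close>.

  The quotient \<open>\<theta> / norm Ainv\<close> can only have a vanishing denominator if both spaces are trivial.
  It is always used through the inequality \<open>near_linear_contraction\<close>, which covers that case.
\<close>

lemma inverse_blinfun_apply:
  assumes "inverse_blinfun A B"
  shows "A (B y) = y" and "B (A x) = x"
  using assms unfolding inverse_blinfun_def
  by (metis blinfun_apply_blinfun_compose blinfun_apply_id_blinfun)+

text \<open>Applying the inverse \<open>B\<close> to the deviation from \<open>A\<close> turns it into the deviation from the
  identity, and the factor \<open>norm B\<close> cancels against the denominator. The resulting inequality is
  what makes the Newton-like map \<open>f \<mapsto> f + B (y - g f)\<close> a contraction.\<close>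

lemma near_linear_contraction:
  fixes A :: "'f::real_normed_vector \<Rightarrow>\<^sub>L 'v::real_normed_vector"
  assumes inv: "inverse_blinfun A B" and "0 \<le> \<theta>"
    and near: "norm (y\<^sub>1 - y\<^sub>2 - A (f\<^sub>1 - f\<^sub>2)) \<le> \<theta> / norm B * norm (f\<^sub>1 - f\<^sub>2)"
  shows "norm (f\<^sub>1 - f\<^sub>2 - B (y\<^sub>1 - y\<^sub>2)) \<le> \<theta> * norm (f\<^sub>1 - f\<^sub>2)"
proof -
  have "B (y\<^sub>1 - y\<^sub>2 - A (f\<^sub>1 - f\<^sub>2)) = B (y\<^sub>1 - y\<^sub>2) - (f\<^sub>1 - f\<^sub>2)"
    by (simp add: blinfun.diff_right inverse_blinfun_apply[OF inv])
  then have "norm (f\<^sub>1 - f\<^sub>2 - B (y\<^sub>1 - y\<^sub>2)) = norm (B (y\<^sub>1 - y\<^sub>2 - A (f\<^sub>1 - f\<^sub>2)))"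
    by (simp add: norm_minus_commute)
  also have "\<dots> \<le> norm B * norm (y\<^sub>1 - y\<^sub>2 - A (f\<^sub>1 - f\<^sub>2))"
    by (rule norm_blinfun)
  also have "\<dots> \<le> norm B * (\<theta> / norm B * norm (f\<^sub>1 - f\<^sub>2))"
    by (intro mult_left_mono near) simp
  also have "\<dots> \<le> \<theta> * norm (f\<^sub>1 - f\<^sub>2)"
    using \<open>0 \<le> \<theta>\<close> by (cases "norm B = 0") simp_all
  finally show ?thesis .
qed

lemma near_linear_lower_bound:
  fixes A :: "'f::real_normed_vector \<Rightarrow>\<^sub>L 'v::real_normed_vector"
  assumes "inverse_blinfun A B" and "0 \<le> \<theta>" and "\<theta> < 1"
    and "norm (y\<^sub>1 - y\<^sub>2 - A (f\<^sub>1 - f\<^sub>2)) \<le> \<theta> / norm B * norm (f\<^sub>1 - f\<^sub>2)"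
  shows "norm (f\<^sub>1 - f\<^sub>2) \<le> norm B / (1 - \<theta>) * norm (y\<^sub>1 - y\<^sub>2)"
proof -
  have "norm (f\<^sub>1 - f\<^sub>2 - B (y\<^sub>1 - y\<^sub>2)) \<le> \<theta> * norm (f\<^sub>1 - f\<^sub>2)"
    using assms(1,2,4) by (rule near_linear_contraction)
  moreover have "norm (B (y\<^sub>1 - y\<^sub>2)) \<le> norm B * norm (y\<^sub>1 - y\<^sub>2)"
    by (rule norm_blinfun)
  moreover have "norm (f\<^sub>1 - f\<^sub>2) \<le> norm (f\<^sub>1 - f\<^sub>2 - B (y\<^sub>1 - y\<^sub>2)) + norm (B (y\<^sub>1 - y\<^sub>2))"
    using norm_triangle_ineq[of "f\<^sub>1 - f\<^sub>2 - B (y\<^sub>1 - y\<^sub>2)" "B (y\<^sub>1 - y\<^sub>2)"] by simp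
  ultimately have "(1 - \<theta>) * norm (f\<^sub>1 - f\<^sub>2) \<le> norm B * norm (y\<^sub>1 - y\<^sub>2)"
    by (simp add: left_diff_distrib)
  then show ?thesis
    using \<open>\<theta> < 1\<close> by (simp add: pos_le_divide_eq mult.commute)
qed

text \<open>The solution is the fixed point of \<open>f \<mapsto> f + B (y - g f)\<close>. This map has Lipschitz constant
  \<open>\<theta>\<close> and moves the centre by at most \<open>(1 - \<theta>) * \<rho>\<close>, so it preserves the ball.\<close>

lemma near_linear_solvable:
  fixes A :: "'f::banach \<Rightarrow>\<^sub>L 'v::real_normed_vector"
  assumes inv: "inverse_blinfun A B" and \<theta>: "0 \<le> \<theta>" "\<theta> < 1" and "0 \<le> \<rho>"
    and near: "\<And>f\<^sub>1 f\<^sub>2. f\<^sub>1 \<in> cball f\<^sub>0 \<rho> \<Longrightarrow> f\<^sub>2 \<in> cball f\<^sub>0 \<rho> \<Longrightarrow>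
      norm (g f\<^sub>1 - g f\<^sub>2 - A (f\<^sub>1 - f\<^sub>2)) \<le> \<theta> / norm B * norm (f\<^sub>1 - f\<^sub>2)"
    and defect: "norm B * norm (y - g f\<^sub>0) \<le> (1 - \<theta>) * \<rho>"
  shows "\<exists>f \<in> cball f\<^sub>0 \<rho>. g f = y"
proof -
  define T where "T = (\<lambda>f. f + B (y - g f))"
  have contr: "dist (T f\<^sub>1) (T f\<^sub>2) \<le> \<theta> * dist f\<^sub>1 f\<^sub>2"
    if "f\<^sub>1 \<in> cball f\<^sub>0 \<rho>" "f\<^sub>2 \<in> cball f\<^sub>0 \<rho>" for f\<^sub>1 f\<^sub>2
  proof -
    have "T f\<^sub>1 - T f\<^sub>2 = f\<^sub>1 - f\<^sub>2 - B (g f\<^sub>1 - g f\<^sub>2)"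
      by (simp add: T_def blinfun.diff_right)
    then show ?thesis
      using near_linear_contraction[OF inv \<theta>(1) near[OF that]] by (simp add: dist_norm)
  qed
  have centre: "dist (T f\<^sub>0) f\<^sub>0 \<le> (1 - \<theta>) * \<rho>"
    using order_trans[OF norm_blinfun defect] by (simp add: T_def dist_norm)
  have "T f \<in> cball f\<^sub>0 \<rho>" if f: "f \<in> cball f\<^sub>0 \<rho>" for f
  proof -
    have "dist (T f) f\<^sub>0 \<le> dist (T f) (T f\<^sub>0) + dist (T f\<^sub>0) f\<^sub>0"
      by (rule dist_triangle)
    also have "\<dots> \<le> \<theta> * dist f f\<^sub>0 + (1 - \<theta>) * \<rho>"
      using contr[OF f] \<open>0 \<le> \<rho>\<close> centre by (intro add_mono) simp_all
    also have "\<dots> \<le> \<theta> * \<rho> + (1 - \<theta>) * \<rho>"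
      using f \<theta>(1) by (intro add_right_mono mult_left_mono) (simp_all add: dist_commute)
    also have "\<dots> = \<rho>"
      by (simp add: algebra_simps)
    finally show ?thesis
      by (simp add: dist_commute)
  qed
  then have "\<exists>!f. f \<in> cball f\<^sub>0 \<rho> \<and> T f = f"
    using \<theta> \<open>0 \<le> \<rho>\<close> contr
    by (intro Banach_fix[where c = \<theta>]) (auto simp: complete_eq_closed)
  then obtain f where f: "f \<in> cball f\<^sub>0 \<rho>" "T f = f"
    by blast
  then have "A (B (y - g f)) = 0"
    by (simp add: T_def)
  then have "g f = y"
    by (simp add: inverse_blinfun_apply[OF inv])
  with f show ?thesis
    by blast
qed

lemma modulus_of_continuity_small:
  assumes "modulus_of_continuity \<omega>" and "0 < \<epsilon>"
  obtains \<delta> where "0 < \<delta>" and "\<And>t. 0 \<le> t \<Longrightarrow> t < \<delta> \<Longrightarrow> \<omega> t < \<epsilon>"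
proof -
  have "eventually (\<lambda>t. \<omega> t < \<epsilon>) (at_right 0)" and zero: "\<omega> 0 = 0"
    using assms unfolding modulus_of_continuity_def by (auto intro: order_tendstoD)
  then obtain \<delta> where "0 < \<delta>" "\<And>t. 0 < t \<Longrightarrow> t < \<delta> \<Longrightarrow> \<omega> t < \<epsilon>"
    unfolding eventually_at_right_field by auto
  then show thesis
    using zero \<open>0 < \<epsilon>\<close> by (metis that less_eq_real_def)
qed

theorem lemma3p1:
  fixes K :: "'v::banach \<Rightarrow>\<^sub>L 'u::banach"
    and A :: "'f::banach \<Rightarrow>\<^sub>L 'v"
    and Ainv :: "'v \<Rightarrow>\<^sub>L 'f"
    and C :: "'u \<Rightarrow> 'f \<Rightarrow> 'v"
    and u\<^sub>0 :: 'u and v\<^sub>0 h :: 'v and f\<^sub>0 :: 'f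
    and r s \<theta> :: real and \<omega>\<^sub>C :: "real \<Rightarrow> real"
  assumes "u\<^sub>0 = K v\<^sub>0"
    and "r > 0" and "s > 0"
    and "modulus_of_continuity \<omega>\<^sub>C"
    and "\<And>u\<^sub>1 u\<^sub>2 f. u\<^sub>1 \<in> ball u\<^sub>0 r \<Longrightarrow> u\<^sub>2 \<in> ball u\<^sub>0 r \<Longrightarrow> f \<in> ball f\<^sub>0 s \<Longrightarrow>
           norm (C u\<^sub>1 f - C u\<^sub>2 f) \<le> \<omega>\<^sub>C (norm (u\<^sub>1 - u\<^sub>2))"
    and "C (K v\<^sub>0) f\<^sub>0 = v\<^sub>0 - h"
    and "inverse_blinfun A Ainv"
    and "0 < \<theta>" and "\<theta> < 1"
    and "\<And>u f\<^sub>1 f\<^sub>2. u \<in> ball u\<^sub>0 r \<Longrightarrow> f\<^sub>1 \<in> ball f\<^sub>0 s \<Longrightarrow> f\<^sub>2 \<in> ball f\<^sub>0 s \<Longrightarrow>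
           norm (C u f\<^sub>1 - C u f\<^sub>2 - A (f\<^sub>1 - f\<^sub>2)) \<le> \<theta> / norm Ainv * norm (f\<^sub>1 - f\<^sub>2)"
  shows "\<exists>r'>0. \<exists>e. e \<in> ball v\<^sub>0 r' \<rightarrow> ball f\<^sub>0 s \<and> e v\<^sub>0 = f\<^sub>0 \<and>
           (\<forall>v \<in> ball v\<^sub>0 r'. K v \<in> ball u\<^sub>0 r \<and> C (K v) (e v) = v - h) \<and>
           (\<forall>v\<^sub>1 \<in> ball v\<^sub>0 r'. \<forall>v\<^sub>2 \<in> ball v\<^sub>0 r'.
              let \<omega>' = (\<lambda>t. norm Ainv / (1 - \<theta>) * (t + \<omega>\<^sub>C (norm K * t)))
              in norm (e v\<^sub>1 - e v\<^sub>2) \<le> \<omega>' (norm (v\<^sub>1 - v\<^sub>2)))"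
proof -
  note C_modulus = assms(5) and inv = assms(7) and C_near = assms(10)
  note \<theta> = less_imp_le[OF \<open>0 < \<theta>\<close>] \<open>\<theta> < 1\<close>
  define \<omega>' where "\<omega>' = (\<lambda>t. norm Ainv / (1 - \<theta>) * (t + \<omega>\<^sub>C (norm K * t)))"
  have \<omega>_mono: "\<omega>\<^sub>C a \<le> \<omega>\<^sub>C b" if "0 \<le> a" "a \<le> b" for a b
    using \<open>modulus_of_continuity \<omega>\<^sub>C\<close> that
    unfolding modulus_of_continuity_def by (meson atLeast_iff mono_onD order_trans)
  have K_diff: "norm (K v\<^sub>1 - K v\<^sub>2) \<le> norm K * norm (v\<^sub>1 - v\<^sub>2)" for v\<^sub>1 v\<^sub>2
    by (metis blinfun.diff_right norm_blinfun)
  have defect: "norm ((v\<^sub>1 - h) - C (K v\<^sub>1) f) \<le> norm (v\<^sub>1 - v\<^sub>2) + \<omega>\<^sub>C (norm K * norm (v\<^sub>1 - v\<^sub>2))"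
    if "K v\<^sub>1 \<in> ball u\<^sub>0 r" "K v\<^sub>2 \<in> ball u\<^sub>0 r" "f \<in> ball f\<^sub>0 s" "C (K v\<^sub>2) f = v\<^sub>2 - h" for v\<^sub>1 v\<^sub>2 f
  proof -
    have "(v\<^sub>1 - h) - C (K v\<^sub>1) f = (v\<^sub>1 - v\<^sub>2) - (C (K v\<^sub>1) f - C (K v\<^sub>2) f)"
      using that(4) by simp
    then have "norm ((v\<^sub>1 - h) - C (K v\<^sub>1) f) \<le> norm (v\<^sub>1 - v\<^sub>2) + norm (C (K v\<^sub>1) f - C (K v\<^sub>2) f)"
      by (metis norm_triangle_ineq4)
    also have "\<dots> \<le> norm (v\<^sub>1 - v\<^sub>2) + \<omega>\<^sub>C (norm K * norm (v\<^sub>1 - v\<^sub>2))"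
      using order_trans[OF C_modulus[OF that(1-3)] \<omega>_mono[OF norm_ge_zero K_diff]] by simp
    finally show ?thesis .
  qed
  have stable: "norm (f\<^sub>1 - f\<^sub>2) \<le> \<omega>' (norm (v\<^sub>1 - v\<^sub>2))"
    if "K v\<^sub>1 \<in> ball u\<^sub>0 r" "K v\<^sub>2 \<in> ball u\<^sub>0 r" "f\<^sub>1 \<in> ball f\<^sub>0 s" "f\<^sub>2 \<in> ball f\<^sub>0 s"
      and "C (K v\<^sub>1) f\<^sub>1 = v\<^sub>1 - h" "C (K v\<^sub>2) f\<^sub>2 = v\<^sub>2 - h" for v\<^sub>1 v\<^sub>2 f\<^sub>1 f\<^sub>2
  proof -
    have "norm (f\<^sub>1 - f\<^sub>2) \<le> norm Ainv / (1 - \<theta>) * norm (C (K v\<^sub>1) f\<^sub>1 - C (K v\<^sub>1) f\<^sub>2)"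
      using that by (intro near_linear_lower_bound[OF inv \<theta>] C_near)
    also have "\<dots> \<le> \<omega>' (norm (v\<^sub>1 - v\<^sub>2))"
      unfolding \<omega>'_def
      using defect[OF that(1,2,4,6)] that(5) \<theta> by (intro mult_left_mono) simp_all
    finally show ?thesis .
  qed
  \<comment> \<open>Solutions are sought at distance at most \<open>s / 2\<close> from \<open>f\<^sub>0\<close>, as a closed ball inside the open
    one is needed for completeness. The number \<open>\<epsilon>\<close> is half of the defect that this radius
    tolerates: one half each for \<open>norm (v - v\<^sub>0)\<close> and for the value of \<open>\<omega>\<^sub>C\<close>. The extra \<open>1\<close> in the
    denominators keeps them positive.\<close>
  define \<epsilon> where "\<epsilon> = (1 - \<theta>) * (s / 2) / (norm Ainv + 1) / 2"
  have "0 < \<epsilon>"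
    using \<theta> \<open>s > 0\<close> unfolding \<epsilon>_def by (intro divide_pos_pos mult_pos_pos) (auto simp: add_nonneg_pos)
  obtain \<delta> where "0 < \<delta>" and \<delta>: "\<And>t. 0 \<le> t \<Longrightarrow> t < \<delta> \<Longrightarrow> \<omega>\<^sub>C t < \<epsilon>"
    using modulus_of_continuity_small[OF \<open>modulus_of_continuity \<omega>\<^sub>C\<close> \<open>0 < \<epsilon>\<close>] by metis
  define r' where "r' = min \<epsilon> (min \<delta> r / (norm K + 1))"
  have "0 < r'"
    using \<open>0 < \<epsilon>\<close> \<open>0 < \<delta>\<close> \<open>r > 0\<close> by (simp add: r'_def add_nonneg_pos)
  have K_small: "norm K * norm (v - v\<^sub>0) < min \<delta> r" if "v \<in> ball v\<^sub>0 r'" for v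
  proof -
    have "norm (v - v\<^sub>0) < min \<delta> r / (norm K + 1)"
      using that by (simp add: r'_def dist_norm norm_minus_commute)
    then have "(norm K + 1) * norm (v - v\<^sub>0) < min \<delta> r"
      by (simp add: pos_less_divide_eq add_nonneg_pos mult.commute)
    moreover have "norm K * norm (v - v\<^sub>0) \<le> (norm K + 1) * norm (v - v\<^sub>0)"
      by (intro mult_right_mono) simp_all
    ultimately show ?thesis
      by linarith
  qed
  have K_ball: "K v \<in> ball u\<^sub>0 r" if "v \<in> ball v\<^sub>0 r'" for v
    using K_diff[of v v\<^sub>0] K_small[OF that] \<open>u\<^sub>0 = K v\<^sub>0\<close> by (simp add: dist_norm norm_minus_commute)
  have centre: "v\<^sub>0 \<in> ball v\<^sub>0 r'" "f\<^sub>0 \<in> ball f\<^sub>0 s"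
    using \<open>0 < r'\<close> \<open>s > 0\<close> by simp_all
  have "\<exists>f. f \<in> ball f\<^sub>0 s \<and> C (K v) f = v - h" if v: "v \<in> ball v\<^sub>0 r'" for v
  proof -
    have "norm ((v - h) - C (K v) f\<^sub>0) \<le> norm (v - v\<^sub>0) + \<omega>\<^sub>C (norm K * norm (v - v\<^sub>0))"
      using K_ball v centre \<open>C (K v\<^sub>0) f\<^sub>0 = v\<^sub>0 - h\<close> by (intro defect)
    also have "\<dots> \<le> \<epsilon> + \<epsilon>"
    proof (rule add_mono)
      show "norm (v - v\<^sub>0) \<le> \<epsilon>"
        using v by (simp add: r'_def dist_norm norm_minus_commute)
      show "\<omega>\<^sub>C (norm K * norm (v - v\<^sub>0)) \<le> \<epsilon>"
        using \<delta>[of "norm K * norm (v - v\<^sub>0)"] K_small[OF v] by simp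
    qed
    finally have "norm Ainv * norm ((v - h) - C (K v) f\<^sub>0) \<le> (norm Ainv + 1) * (\<epsilon> + \<epsilon>)"
      by (intro mult_mono) simp_all
    also have "\<dots> = (1 - \<theta>) * (s / 2)"
    proof -
      have "norm Ainv + 1 \<noteq> 0"
        using norm_ge_zero[of Ainv] by linarith
      then show ?thesis
        unfolding \<epsilon>_def field_sum_of_halves by (metis nonzero_eq_divide_eq mult.commute)
    qed
    finally have "norm Ainv * norm ((v - h) - C (K v) f\<^sub>0) \<le> (1 - \<theta>) * (s / 2)" .
    moreover have sub: "cball f\<^sub>0 (s / 2) \<subseteq> ball f\<^sub>0 s"
      using \<open>s > 0\<close> by auto
    ultimately have "\<exists>f \<in> cball f\<^sub>0 (s / 2). C (K v) f = v - h"
      using K_ball[OF v] \<open>s > 0\<close>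
      by (intro near_linear_solvable[OF inv \<theta>] C_near) auto
    with sub show ?thesis
      by blast
  qed
  then obtain e where e: "\<And>v. v \<in> ball v\<^sub>0 r' \<Longrightarrow> e v \<in> ball f\<^sub>0 s \<and> C (K v) (e v) = v - h"
    by metis
  have "norm (e v\<^sub>0 - f\<^sub>0) \<le> \<omega>' (norm (v\<^sub>0 - v\<^sub>0))"
    using e K_ball centre \<open>C (K v\<^sub>0) f\<^sub>0 = v\<^sub>0 - h\<close> by (intro stable) auto
  then have "e v\<^sub>0 = f\<^sub>0"
    using \<open>modulus_of_continuity \<omega>\<^sub>C\<close> by (simp add: \<omega>'_def modulus_of_continuity_def)
  moreover have "norm (e v\<^sub>1 - e v\<^sub>2) \<le> \<omega>' (norm (v\<^sub>1 - v\<^sub>2))"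
    if "v\<^sub>1 \<in> ball v\<^sub>0 r'" "v\<^sub>2 \<in> ball v\<^sub>0 r'" for v\<^sub>1 v\<^sub>2
    using that e K_ball by (intro stable) auto
  ultimately show ?thesis
    using \<open>0 < r'\<close> e K_ball unfolding Let_def \<omega>'_def
    by (intro exI[of _ r'] exI[of _ e] conjI ballI) auto
qed

end
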